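(* Let $p\ge 5$ be a prime and let $a$ and $n$ be positive integers such that $\gcd(a,p)=1$. Let $k$ be an odd integer with $1\le k\le ap^n-1$. Then: if $v_p(s(ap^n,ap^n-k+1))\le 2n-1$, then $v_p(s(ap^n,ap^n-k))=v_p(s(ap^n,ap^n-k+1))+v_p(ap^n-k)+n$; and if $v_p(s(ap^n,ap^n-k+1))\ge 2n$, then $v_p(s(ap^n,ap^n-k))\ge v_p(ap^n-k)+3n$.
   Context: For nonnegative integers $n,k$, the (unsigned) Stirling numbers of the first kind $s(n,k)$ are defined by $x(x+1)\cdots(x+n-1)=\sum_{k=0}^n s(n,k)x^k$. $v_p$ denotes the $p$-adic valuation (with $v_p(0)=+\infty$). *)

theory Defs
  imports
    "HOL-Combinatorics.Stirling"
    "HOL-Computational_Algebra.Primes"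
    "HOL-Library.Extended_Nat"
begin

text \<open>
  The library's \<^const>\<open>multiplicity\<close> returns 0 at 0, so it is corrected to the
  convention that 0 has infinite valuation.
\<close>

definition vp :: "nat \<Rightarrow> nat \<Rightarrow> enat" where
  "vp p x = (if x = 0 then \<infinity> else enat (multiplicity p x))"

text \<open>
  The library's \<^const>\<open>stirling\<close> is defined by recursion. Its coefficients are those of
  the rising factorial.
\<close>

lemma stirling_rising_factorial:
  "(\<Prod>i<n. x + of_nat i) = (\<Sum>k\<le>n. of_nat (stirling n k) * (x :: 'a :: comm_semiring_1) ^ k)"
  using stirling_pochhammer[of n x]
  by (simp add: pochhammer_prod atLeast0LessThan)

end

theory Submission
  imports Defs "HOL-Computational_Algebra.Polynomial"
begin

text \<open>
  Put \<open>N = a p\<^sup>n\<close>, \<open>e\<^sub>i = s(N, N - i)\<close> and \<open>Q(x) = (x + 1) \<cdots> (x + N - 1)\<close>. The reflection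
  \<open>Q(-N - x) = (-1)\<^bsup>N-1\<^esup> Q(x)\<close> gives, on comparing coefficients for odd \<open>k\<close>,
  \<open>2 e\<^sub>k = (\<Sum>i<k. (-1)\<^sup>i C(N-1-i, k-i) N\<^bsup>k-i\<^esup> e\<^sub>i)\<close>. The term \<open>i = k - 1\<close> is \<open>(N - k) N e\<^bsub>k-1\<^esub>\<close>.
  Since \<open>j C(N-1-i, j) = (N - k) C(N-1-i, j-1)\<close> for \<open>j = k - i\<close>, all other terms are divisible by
  \<open>p\<^sup>3\<^sup>n\<close> times the \<open>p\<close>-part of \<open>N - k\<close>: for \<open>j \<ge> 3\<close> because of the factor \<open>N\<^sup>j\<close>, and for \<open>j = 2\<close>
  because \<open>k - 2\<close> is odd, so that \<open>p\<^sup>n\<close> divides \<open>e\<^bsub>k-2\<^esub>\<close>.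
\<close>

section \<open>The polynomial Q and its reflection\<close>

lemma stirling_poly:
  "(\<Sum>j\<le>M. monom (int (stirling (Suc M) (Suc j))) j) = (\<Prod>i<M. [:int (Suc i), 1:])"
proof -
  let ?X = "[:0, 1:] :: int poly"
  have "(\<Sum>k\<le>Suc M. of_nat (stirling (Suc M) k) * ?X ^ k) = (\<Prod>i<Suc M. ?X + of_nat i)"
    using stirling_rising_factorial[where x = ?X and n = "Suc M"] by simp
  also have "\<dots> = ?X * (\<Prod>i<M. [:int (Suc i), 1:])"
    by (subst prod.lessThan_Suc_shift) (simp add: of_nat_poly one_pCons)
  finally have 1: "(\<Sum>k\<le>Suc M. of_nat (stirling (Suc M) k) * ?X ^ k)
      = ?X * (\<Prod>i<M. [:int (Suc i), 1:])" .
  \<comment> \<open>The term k = 0 vanishes because \<open>stirling (Suc M) 0 = 0\<close>, so a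
    factor \<open>?X\<close> can be pulled out of the sum and cancelled.\<close>
  have "(\<Sum>k\<le>Suc M. of_nat (stirling (Suc M) k) * ?X ^ k)
      = (\<Sum>j\<le>M. of_nat (stirling (Suc M) (Suc j)) * ?X ^ Suc j)"
    by (subst sum.atMost_Suc_shift) simp
  also have "\<dots> = ?X * (\<Sum>j\<le>M. monom (int (stirling (Suc M) (Suc j))) j)"
    unfolding sum_distrib_left
    by (intro sum.cong refl) (simp add: monom_altdef of_nat_poly del: stirling.simps)
  finally show ?thesis using 1 mult_left_cancel[of ?X] by (simp only: pCons_eq_0_iff) simp
qed

text \<open>The substitution turns the factor x + i + 1 into -(x + M - i). The factors are thus
  listed in reverse order, each with a sign.\<close>

lemma stirling_poly_reflect:
  "pcompose (\<Prod>i<M. [:int (Suc i), 1:]) [:- int (Suc M), -1:]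
    = smult ((-1) ^ M) (\<Prod>i<M. [:int (Suc i), 1:])"
proof -
  have "pcompose (\<Prod>i<M. [:int (Suc i), 1:]) [:- int (Suc M), -1:]
      = (\<Prod>i<M. [:int (Suc i) - int (Suc M), -1:])"
    by (simp add: pcompose_prod pcompose_pCons)
  also have "\<dots> = (\<Prod>i<M. [:int (Suc (M - Suc i)) - int (Suc M), -1:])"
    by (rule prod.nat_diff_reindex[symmetric])
  also have "\<dots> = (\<Prod>i<M. smult (-1) [:int (Suc i), 1:])"
    by (intro prod.cong refl) (auto simp: of_nat_diff)
  also have "\<dots> = smult ((-1) ^ M) (\<Prod>i<M. [:int (Suc i), 1:])"
  proof -
    have "(\<Prod>i<m. smult (-1) (f i)) = smult ((-1) ^ m) (\<Prod>i<m. f i)"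
      for f :: "nat \<Rightarrow> int poly" and m
      by (induct m) simp_all
    then show ?thesis .
  qed
  finally show ?thesis .
qed

text \<open>Comparison of the coefficients of x^(M-k) in the reflection of Q. The number e_i is the
  coefficient of x^(M-i).\<close>

lemma stirling_reflection:
  assumes "k \<le> M"
  shows "int (stirling (Suc M) (Suc M - k)) =
    (\<Sum>i\<le>k. (-1) ^ i * int ((M - i) choose (k - i)) * int (Suc M) ^ (k - i)
      * int (stirling (Suc M) (Suc M - i)))"
proof -
  define q where "q j = int (stirling (Suc M) (Suc j))" for j
  define m where "m = M - k"
  have mM: "m \<le> M" by (simp add: m_def)
  let ?Q = "\<Sum>j\<le>M. monom (q j) j"
  have comp: "pcompose (monom c j) r = smult c (r ^ j)" for c :: int and j r
    by (induct j) (simp_all add: monom_0 monom_Suc pcompose_pCons mult.commute)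
  \<comment> \<open>Binomial theorem. The signs from x^m and N^(j-m) combine to
    \<open>(-1) ^ j\<close>. For j < m the truncated exponent \<open>j - m\<close> is harmless,
    since the binomial coefficient is 0.\<close>
  have co: "coeff ([:- int (Suc M), -1:] ^ j) m
      = (-1) ^ j * int (j choose m) * int (Suc M) ^ (j - m)" for j
  proof (cases "m \<le> j")
    case True
    have "(-1 :: int) ^ m * (- int (Suc M)) ^ (j - m) = (-1) ^ j * int (Suc M) ^ (j - m)"
      using True by (subst power_minus) (simp flip: power_add add: mult.assoc[symmetric])
    then show ?thesis
      using True by (simp add: coeff_linear_poly_power mult.assoc mult.left_commute del: of_nat_Suc)
  next
    case False
    have "degree ([:- int (Suc M), -1:] ^ j) \<le> j"
      using degree_power_le[of "[:- int (Suc M), -1:]" j] by simp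
    then show ?thesis using False by (simp add: coeff_eq_0 binomial_eq_0)
  qed
  have "coeff (pcompose ?Q [:- int (Suc M), -1:]) m = coeff (smult ((-1) ^ M) ?Q) m"
    using stirling_poly_reflect[of M] stirling_poly[of M] by (simp only: q_def)
  then have "(\<Sum>j\<le>M. q j * ((-1) ^ j * int (j choose m) * int (Suc M) ^ (j - m))) = (-1) ^ M * q m"
    using mM by (simp add: pcompose_sum comp coeff_sum co if_distrib del: of_nat_Suc cong: if_cong)
  moreover have "(\<Sum>j\<le>M. q j * ((-1) ^ j * int (j choose m) * int (Suc M) ^ (j - m)))
     = (\<Sum>j\<in>{m..M}. q j * ((-1) ^ j * int (j choose m) * int (Suc M) ^ (j - m)))"
    by (rule sum.mono_neutral_right) (auto simp: binomial_eq_0)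
  \<comment> \<open>Reindexing by j = M - i; the range j \<ge> m becomes i \<le> k since m = M -
    k.\<close>
  moreover have "\<dots> = (\<Sum>i\<le>k. q (M - i) *
      ((-1) ^ (M - i) * int ((M - i) choose m) * int (Suc M) ^ (M - i - m)))"
    by (rule sum.reindex_bij_witness[of _ "\<lambda>i. M - i" "\<lambda>j. M - j"])
       (use assms in \<open>auto simp: m_def\<close>)
  ultimately have "(-1) ^ M * q m = (\<Sum>i\<le>k. q (M - i) *
      ((-1) ^ (M - i) * int ((M - i) choose m) * int (Suc M) ^ (M - i - m)))"
    by simp
  \<comment> \<open>A second factor \<open>(-1) ^ M\<close> clears the sign on the left and turns
    \<open>(-1) ^ (M - i)\<close> into \<open>(-1) ^ i\<close> on the right.\<close>
  then have "(-1) ^ M * ((-1) ^ M * q m) = (\<Sum>i\<le>k. (-1) ^ M * (q (M - i) *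
      ((-1) ^ (M - i) * int ((M - i) choose m) * int (Suc M) ^ (M - i - m))))"
    by (simp only: sum_distrib_left)
  also have "\<dots> = (\<Sum>i\<le>k. (-1) ^ i * int ((M - i) choose (k - i)) * int (Suc M) ^ (k - i)
      * int (stirling (Suc M) (Suc M - i)))"
  proof (intro sum.cong refl)
    fix i assume i: "i \<in> {..k}"
    have "(M - i) choose m = (M - i) choose (k - i)"
      using i assms by (subst binomial_symmetric) (auto simp: m_def)
    moreover have "M - i - m = k - i" "Suc M - i = Suc (M - i)"
      using i assms by (auto simp: m_def)
    moreover have "(-1 :: int) ^ M * (-1) ^ (M - i) = (-1) ^ i"
    proof -
      have "M + (M - i) = i + 2 * (M - i)" using i assms by auto
      then have "(-1 :: int) ^ (M + (M - i)) = (-1) ^ (i + 2 * (M - i))" by (rule arg_cong)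
      then show ?thesis by (simp only: power_add power_mult) simp
    qed
    moreover have "(-1) ^ M * (q (M - i) *
        ((-1) ^ (M - i) * int ((M - i) choose m) * int (Suc M) ^ (M - i - m)))
      = ((-1) ^ M * (-1) ^ (M - i)) * int ((M - i) choose m) * int (Suc M) ^ (M - i - m)
        * q (M - i)"
      by (simp only: mult_ac)
    ultimately show "(-1) ^ M * (q (M - i) *
        ((-1) ^ (M - i) * int ((M - i) choose m) * int (Suc M) ^ (M - i - m)))
      = (-1) ^ i * int ((M - i) choose (k - i)) * int (Suc M) ^ (k - i)
        * int (stirling (Suc M) (Suc M - i))"
      by (simp only: q_def)
  qed
  finally show ?thesis
    using assms by (simp add: q_def m_def Suc_diff_le mult.assoc[symmetric] del: stirling.simps of_nat_Suc)
qed

text \<open>For odd k the term i = k of the reflection formula is -e_k; moving it to the left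
  doubles e_k.\<close>

lemma two_stirling_odd:
  assumes "k \<le> M" "odd k"
  shows "2 * int (stirling (Suc M) (Suc M - k)) =
    (\<Sum>i<k. (-1) ^ i * int ((M - i) choose (k - i)) * int (Suc M) ^ (k - i)
      * int (stirling (Suc M) (Suc M - i)))"
  using stirling_reflection[OF assms(1)] assms(2)
  by (simp add: lessThan_Suc_atMost[symmetric] del: stirling.simps of_nat_Suc)

section \<open>Divisibility by powers of p\<close>

lemma prime_power_dvd_odd_stirling:
  fixes p n M k :: nat
  assumes "odd p" "p ^ n dvd Suc M" "k \<le> M" "odd k"
  shows "p ^ n dvd stirling (Suc M) (Suc M - k)"
proof -
  have "int (p ^ n) dvd 2 * int (stirling (Suc M) (Suc M - k))"
    unfolding two_stirling_odd[OF assms(3,4)]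
  proof (rule dvd_sum)
    fix i assume "i \<in> {..<k}"
    \<comment> \<open>Since i < k, every term carries a positive power of N. The factor 2 is removed
      afterwards, as p is odd.\<close>
    then have "Suc M dvd Suc M ^ (k - i)" by (auto intro: dvd_power)
    then have "int (p ^ n) dvd int (Suc M) ^ (k - i)"
      using assms(2) by (metis dvd_trans of_nat_dvd_iff of_nat_power)
    then show "int (p ^ n) dvd (-1) ^ i * int ((M - i) choose (k - i)) * int (Suc M) ^ (k - i)
      * int (stirling (Suc M) (Suc M - i))"
      by (intro dvd_mult2 dvd_mult)
  qed
  then have "p ^ n dvd 2 * stirling (Suc M) (Suc M - k)"
    by (metis of_nat_dvd_iff of_nat_mult of_nat_numeral)
  moreover have "coprime (p ^ n) 2" using assms(1) by simp
  ultimately show ?thesis using coprime_dvd_mult_right_iff by blast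
qed

text \<open>By j C(r+j-1, j) = r C(r+j-1, j-1), the power \<open>p ^ v\<close> divides the left
  side. Dividing by j costs at most the p-part of j, which the extra factor restores.\<close>

lemma prime_power_dvd_binomial:
  fixes p v r j :: nat
  assumes "prime p" "p ^ v dvd r" "r > 0" "j > 0"
  shows "p ^ v dvd ((r + j - 1) choose j) * p ^ multiplicity p j"
proof -
  obtain j' where j': "j = p ^ multiplicity p j * j'" "\<not> p dvd j'"
    using multiplicity_decompose'[of j p] assms(4) prime_gt_1_nat[OF assms(1)] by auto
  have "j * ((r + j - 1) choose j) = r * ((r + j - 1) choose (j - 1))"
    using Suc_times_binomial_add[of "j - 1" "r - 1"] assms
    by (simp add: mult.commute Suc_diff_Suc add.commute Suc_diff_le)
  then have "p ^ v dvd j * ((r + j - 1) choose j)"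
    using assms(2) by simp
  then have "p ^ v dvd j' * (((r + j - 1) choose j) * p ^ multiplicity p j)"
    by (metis j'(1) mult.assoc mult.commute)
  moreover have "coprime (p ^ v) j'"
    using j'(2) assms(1) by (simp add: prime_imp_coprime)
  ultimately show ?thesis using coprime_dvd_mult_right_iff by blast
qed

text \<open>For w = \<open>multiplicity p j\<close> > 0 one has j \<ge> p^w \<ge> 5^w \<ge> w + 3.
  With p = 3 this would fail at j = 3.\<close>

lemma multiplicity_add_3_le:
  fixes p j :: nat
  assumes "p \<ge> 5" "j \<ge> 3"
  shows "multiplicity p j + 3 \<le> j"
proof (cases "multiplicity p j = 0")
  case False
  have "w \<noteq> 0 \<Longrightarrow> w + 3 \<le> 5 ^ w" for w :: nat
    by (induct w) (auto, case_tac w, auto)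
  then have "multiplicity p j + 3 \<le> 5 ^ multiplicity p j" using False by blast
  also have "\<dots> \<le> p ^ multiplicity p j" using assms by (intro power_mono) auto
  also have "\<dots> \<le> j" using assms by (intro dvd_imp_le multiplicity_dvd) auto
  finally show ?thesis .
qed (use assms in auto)

text \<open>Three of the j factors \<open>p ^ n\<close> supply the exponent 3n; the other j - 3 pay
  for the p-part of j lost in the binomial coefficient.\<close>

lemma prime_power_dvd_binomial_mult_power:
  fixes p v r j n :: nat
  assumes "prime p" "p \<ge> 5" "p ^ v dvd r" "r > 0" "j \<ge> 3" "n > 0"
  shows "p ^ (v + 3 * n) dvd ((r + j - 1) choose j) * (p ^ n) ^ j"
proof -
  obtain d where d: "j = multiplicity p j + 3 + d"
    using multiplicity_add_3_le[OF assms(2,5)] nat_le_iff_add by blast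
  have "multiplicity p j + 3 * n \<le> n * j"
  proof -
    have "multiplicity p j \<le> n * multiplicity p j" using assms(6) by simp
    moreover have "n * j = n * multiplicity p j + 3 * n + n * d"
      by (subst d) (simp add: algebra_simps)
    ultimately show ?thesis by linarith
  qed
  then have "p ^ multiplicity p j * p ^ (3 * n) dvd (p ^ n) ^ j"
    unfolding power_add[symmetric] power_mult[symmetric] by (rule le_imp_power_dvd)
  then have "((r + j - 1) choose j) * (p ^ multiplicity p j * p ^ (3 * n))
      dvd ((r + j - 1) choose j) * (p ^ n) ^ j"
    by (rule mult_dvd_mono[OF dvd_refl])
  moreover have "p ^ v * p ^ (3 * n) dvd ((r + j - 1) choose j) * p ^ multiplicity p j * p ^ (3 * n)"
    using prime_power_dvd_binomial[OF assms(1,3,4), of j] assms(5) by (intro mult_dvd_mono) auto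
  ultimately show ?thesis unfolding power_add mult.assoc by (rule dvd_trans[rotated])
qed

text \<open>Isolates the term i = k - 1 in the formula for 2 e_k. Every earlier term has j = k - i
  \<ge> 2 and vanishes modulo \<open>p ^ (v + 3 * n)\<close>.\<close>

lemma stirling_odd_cong:
  fixes p n M k v :: nat
  assumes "prime p" "p \<ge> 5" "n > 0" "p ^ n dvd Suc M" "k \<le> M" "odd k"
    and v: "p ^ v dvd Suc M - k"
  shows "int (p ^ (v + 3 * n)) dvd 2 * int (stirling (Suc M) (Suc M - k))
    - int ((Suc M - k) * Suc M * stirling (Suc M) (Suc M - k + 1))"
proof -
  define t where "t i = (-1) ^ i * int ((M - i) choose (k - i)) * int (Suc M) ^ (k - i)
      * int (stirling (Suc M) (Suc M - i))" for i
  have odd_p: "odd p" using assms prime_odd_nat by auto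
  obtain l where l: "k = Suc l" "even l" using \<open>odd k\<close> by (cases k) auto
  \<comment> \<open>Here l = k - 1 is even, so the sign is positive, and C(M - l, 1) = N -
    k.\<close>
  have "t l = int ((Suc M - k) * Suc M * stirling (Suc M) (Suc M - k + 1))"
    using l assms(5) by (simp add: t_def Suc_diff_le del: stirling.simps of_nat_Suc mult_Suc mult_Suc_right)
  then have "2 * int (stirling (Suc M) (Suc M - k))
    - int ((Suc M - k) * Suc M * stirling (Suc M) (Suc M - k + 1)) = (\<Sum>i<l. t i)"
    using two_stirling_odd[OF assms(5,6)] l by (simp add: t_def del: stirling.simps of_nat_Suc)
  also have "int (p ^ (v + 3 * n)) dvd \<dots>"
  proof (rule dvd_sum)
    fix i assume "i \<in> {..<l}"
    then have i: "i < l" by simp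
    define j r where "j = k - i" and "r = Suc M - k"
    have r: "r > 0" "p ^ v dvd r" using assms by (auto simp: r_def)
    \<comment> \<open>Brings the binomial coefficient C(M - i, j) to the shape C(r+j-1, j) treated
      above.\<close>
    have Mi: "M - i = r + j - 1" using i l assms by (auto simp: r_def j_def)
    have pN: "(p ^ n) ^ j dvd Suc M ^ j" using assms(4) by (rule dvd_power_same)
    have "p ^ (v + 3 * n) dvd ((r + j - 1) choose j) * Suc M ^ j * stirling (Suc M) (Suc M - i)"
    proof (cases "j \<ge> 3")
      case True
      have "((r + j - 1) choose j) * (p ^ n) ^ j dvd ((r + j - 1) choose j) * Suc M ^ j"
        using pN by (rule mult_dvd_mono[OF dvd_refl])
      with prime_power_dvd_binomial_mult_power[OF assms(1,2) r(2,1) True assms(3)]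
      show ?thesis by (meson dvd_mult2 dvd_trans)
    next
      case False
      then have j: "j = 2" using i l by (auto simp: j_def)
      \<comment> \<open>Dividing by j = 2 loses no power of p.\<close>
      have "multiplicity p 2 = 0"
        using assms(2) by (intro not_dvd_imp_multiplicity_0) (auto dest: dvd_imp_le)
      then have "p ^ v dvd ((r + j - 1) choose j)"
        using prime_power_dvd_binomial[OF assms(1) r(2,1), of j] j by simp
      \<comment> \<open>The factor N^2 gives only the exponent 2n; the missing n comes from e_i,
        where i = k - 2 is odd.\<close>
      moreover have "p ^ n dvd stirling (Suc M) (Suc M - i)"
      proof (intro prime_power_dvd_odd_stirling odd_p)
        have "l = Suc i" using j i l by (simp add: j_def)
        then show "odd i" using l by simp
      qed (use i l assms in auto)
      ultimately have "p ^ v * (p ^ n) ^ j * p ^ n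
          dvd ((r + j - 1) choose j) * Suc M ^ j * stirling (Suc M) (Suc M - i)"
        using pN by (intro mult_dvd_mono)
      moreover have "p ^ v * (p ^ n) ^ j * p ^ n = p ^ (v + 3 * n)"
        by (simp add: j power_mult[symmetric] power_add[symmetric] algebra_simps)
      ultimately show ?thesis by simp
    qed
    then have "int (p ^ (v + 3 * n)) dvd
      int (((r + j - 1) choose j) * Suc M ^ j * stirling (Suc M) (Suc M - i))"
      by (simp only: of_nat_dvd_iff)
    then show "int (p ^ (v + 3 * n)) dvd t i"
      unfolding t_def Mi j_def[symmetric] by (simp add: mult.assoc del: stirling.simps of_nat_Suc)
  qed
  finally show ?thesis .
qed

section \<open>From congruences to valuations\<close>

lemma enat_le_vp_iff:
  assumes "prime p"
  shows "enat m \<le> vp p x \<longleftrightarrow> p ^ m dvd x"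
  using power_dvd_iff_le_multiplicity[of x p m] prime_gt_1_nat[OF assms] by (auto simp: vp_def)

lemma vp_mult:
  assumes "prime p"
  shows "vp p (x * y) = vp p x + vp p y"
  using assms by (auto simp: vp_def prime_elem_multiplicity_mult_distrib)

text \<open>Both numbers are divisible by the same \<open>p ^ j\<close> for j \<le> m. Strictness of
  the bound keeps the exponent \<open>Suc w\<close>, which rules out a larger valuation, within this
  range.\<close>

lemma vp_eqI:
  assumes "prime p" "int p ^ m dvd int x - int y" "vp p y < enat m"
  shows "vp p x = vp p y"
proof -
  have iff: "p ^ j dvd x \<longleftrightarrow> p ^ j dvd y" if "j \<le> m" for j
  proof -
    have "int p ^ j dvd int x - int y"
      using that assms(2) by (meson dvd_trans le_imp_power_dvd)
    then have "int p ^ j dvd int x \<longleftrightarrow> int p ^ j dvd int y"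
      by (metis diff_add_cancel dvd_add_right_iff)
    then show ?thesis by (metis of_nat_dvd_iff of_nat_power)
  qed
  obtain w where w: "vp p y = enat w" using assms(3) by (cases "vp p y") auto
  then have "w < m" using assms(3) by simp
  moreover have "enat w \<le> vp p y" "\<not> enat (Suc w) \<le> vp p y" using w by auto
  ultimately have "enat w \<le> vp p x" "\<not> enat (Suc w) \<le> vp p x"
    using iff[of w] iff[of "Suc w"] enat_le_vp_iff[OF assms(1)] by auto
  then show ?thesis using w by (cases "vp p x") auto
qed

theorem theorem1p3:
  fixes p a n k :: nat
  assumes "prime p" and "p \<ge> 5"
    and "a > 0" and "n > 0"
    and "gcd a p = 1"
    and "odd k" and "1 \<le> k" and "k \<le> a * p ^ n - 1"
  shows
    "(vp p (stirling (a * p ^ n) (a * p ^ n - k + 1)) \<le> enat (2 * n - 1) \<longrightarrow>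
        vp p (stirling (a * p ^ n) (a * p ^ n - k)) =
          vp p (stirling (a * p ^ n) (a * p ^ n - k + 1)) + vp p (a * p ^ n - k) + enat n) \<and>
     (vp p (stirling (a * p ^ n) (a * p ^ n - k + 1)) \<ge> enat (2 * n) \<longrightarrow>
        vp p (stirling (a * p ^ n) (a * p ^ n - k)) \<ge> vp p (a * p ^ n - k) + enat (3 * n))"
proof -
  define N where "N = a * p ^ n"
  define r where "r = N - k"
  define v where "v = multiplicity p r"
  define x where "x = stirling N (N - k)"
  define y where "y = stirling N (N - k + 1)"
  have "N > 0" using assms by (auto simp: N_def prime_gt_0_nat)
  then obtain M where M: "N = Suc M" by (cases N) auto
  have kM: "k \<le> M" using assms(8) M by (simp add: N_def[symmetric])
  have r: "r > 0" using kM M by (simp add: r_def)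
  have vr: "vp p r = enat v" using r by (simp add: vp_def v_def)
  have p2: "\<not> p dvd 2" using assms(2) by (auto dest: dvd_imp_le)
  have "\<not> p dvd a" using assms(1,5) by (metis gcd_nat.absorb2 not_prime_unit is_unit_gcd_iff gcd_dvd1)
  then have vN: "vp p N = enat n"
    using assms(1,3) by (auto simp: vp_def N_def prime_gt_0_nat intro!: multiplicity_eqI)
  have "vp p 2 = 0" using p2 by (simp add: vp_def not_dvd_imp_multiplicity_0 zero_enat_def)
  then have v2: "vp p (2 * x) = vp p x" using vp_mult[OF assms(1)] by simp
  have vm: "vp p (r * N * y) = vp p y + enat (v + n)"
    by (simp add: vp_mult[OF assms(1)] vr vN add.commute)
  have cong: "int p ^ (v + 3 * n) dvd int (2 * x) - int (r * N * y)"
    using stirling_odd_cong[OF assms(1,2,4) _ kM assms(6), of v] multiplicity_dvd[of p r]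
    by (simp add: x_def y_def r_def v_def M[symmetric] N_def[symmetric])
       (simp add: N_def)
  have "vp p x = vp p y + vp p r + enat n" if "vp p y \<le> enat (2 * n - 1)"
  proof -
    \<comment> \<open>The valuation is at most (2n - 1) + v + n; as n > 0, the subtraction does not
      truncate and the bound is strict.\<close>
    have "vp p (r * N * y) < enat (v + 3 * n)"
      using that assms(4) vm by (cases "vp p y") auto
    then have "vp p x = vp p (r * N * y)"
      using vp_eqI[OF assms(1) cong] v2 by simp
    then show ?thesis by (simp add: vm vr add.assoc)
  qed
  moreover have "vp p x \<ge> vp p r + enat (3 * n)" if "vp p y \<ge> enat (2 * n)"
  proof -
    \<comment> \<open>Now \<open>r * N * y\<close> vanishes modulo \<open>p ^ (v + 3 * n)\<close>,
      so the congruence gives only a lower bound for the valuation of \<open>2 * x\<close>.\<close>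
    have "enat (v + 3 * n) \<le> vp p (r * N * y)"
      using that vm by (cases "vp p y") auto
    then have "p ^ (v + 3 * n) dvd r * N * y" by (simp only: enat_le_vp_iff[OF assms(1)])
    then have "int p ^ (v + 3 * n) dvd int (r * N * y)" by (metis of_nat_dvd_iff of_nat_power)
    then have "int p ^ (v + 3 * n) dvd int (2 * x)" using cong by (metis diff_add_cancel dvd_add)
    then have "p ^ (v + 3 * n) dvd 2 * x" by (metis of_nat_dvd_iff of_nat_power)
    then show ?thesis using v2 by (simp add: enat_le_vp_iff[OF assms(1), symmetric] vr)
  qed
  ultimately show ?thesis by (simp add: x_def y_def r_def N_def)
qed

end
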